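(* Let $X_e=(X_1,X_2)\in\mathcal M$ be a configuration of two point vortices on the hyperbolic plane with nonzero real vorticities $\Gamma_1,\Gamma_2$ and hyperbolic distance $c=d(X_1,X_2)$. Let $\mu=\mathbf J(X_1,X_2)=\Gamma_1X_1+\Gamma_2X_2$ be its momentum value. Then $X_e$ is $SL(2,\mathbb{R})_\mu$-stable if the vortex strengths $\Gamma_1,\Gamma_2$ are of the same sign or, if they are of opposite sign, the vortices satisfy $$c<\bigl|\ln|\Gamma_1|-\ln|\Gamma_2|\bigr|.$$ Otherwise $X_e$ is only leafwise stable; that is, it is leafwise stable but not $SL(2,\mathbb{R})_\mu$-stable.
   Context: On $\mathbb{R}^3$ let $\langle X_1,X_2\rangle_{\mathcal H}=x_1x_2+y_1y_2-z_1z_2$ and $X_1\times_{\mathcal H}X_2=(y_1z_2-z_1y_2,\ z_1x_2-x_1z_2,\ -x_1y_2+y_1x_2)$. The hyperbolic plane is $\mathcal H_2=\{(x,y,z)\in\mathbb{R}^3\mid z^2-x^2-y^2=1,\ z>0\}$ with the metric $dx^2+dy^2-dz^2$, whose distance satisfies $\langle X_1,X_2\rangle_{\mathcal H}=-\cosh d(X_1,X_2)$. The phase space is $\mathcal M=\{(X_1,X_2)\in\mathcal H_2\times\mathcal H_2\mid X_1\ne X_2\}$. The dynamics is $$\dot X_r=\frac1\pi\sum_{p\ne r}\Gamma_p\frac{X_p\times_{\mathcal H}X_r}{\langle X_r,X_p\rangle_{\mathcal H}^2-1},\qquad r=1,2.$$ The group $SL(2,\mathbb{R})$ acts on $\mathbb{R}^3$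 by conjugation $\rho\mapsto g\rho g^{-1}$ under the identification $(x,y,z)\leftrightarrow\begin{pmatrix} x & y+z \\ y-z & -x \end{pmatrix}$; this preserves $\mathcal H_2$ and acts diagonally on $\mathcal M$. The momentum map $\mathbf J:\mathcal M\to\mathbb{R}^3\cong\mathfrak{sl}(2,\mathbb{R})^*$ is equivariant for this action and is conserved by the dynamics; $SL(2,\mathbb{R})_\mu$ is the isotropy subgroup of $\mu$ for this action on $\mathbb{R}^3$. A point $X_e\in\mathcal M$ is a relative equilibrium if the trajectory through it is contained in its $SL(2,\mathbb{R})$-orbit; every $X_e\in\mathcal M$ in the two-vortex system is a relative equilibrium. For a subgroup $G'\subseteq SL(2,\mathbb{R})$, a relative equilibrium $X_e$ is $G'$-stable if for every $G'$-invariant open neighbourhood $V$ of $X_e$ in $\mathcal M$ there is a $G'$-invariant open neighbourhood $U$ of $X_e$ in $\mathcal M$ such that every trajectory intersecting $U$ lies entirely within $V$. It is leafwise stable if the same property holds with $G'=SL(2,\mathbb{R})_\mu$ for the dynamics restricted to the level set $\mathbf J^{-1}(\mu)$, with $U,V$ being $SL(2,\mathbb{R})_\mu$-invariant open neighbourhoods of $X_e$ in $\mathbf J^{-1}(\mu)$. *)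

theory Defs
  imports "HOL-Analysis.Analysis"
begin

definition hinner :: "real^3 \<Rightarrow> real^3 \<Rightarrow> real" where
  "hinner X Y = X$1 * Y$1 + X$2 * Y$2 - X$3 * Y$3"

definition hcross :: "real^3 \<Rightarrow> real^3 \<Rightarrow> real^3" where
  "hcross X Y = vector [X$2 * Y$3 - X$3 * Y$2,
                        X$3 * Y$1 - X$1 * Y$3,
                        - X$1 * Y$2 + X$2 * Y$1]"

definition hyp_plane :: "(real^3) set" where
  "hyp_plane = {X. (X$3)\<^sup>2 - (X$1)\<^sup>2 - (X$2)\<^sup>2 = 1 \<and> X$3 > 0}"

text \<open>On the hyperboloid \<open>- hinner X Y \<ge> 1\<close>, so this is the unique nonnegative
  solution \<open>d\<close> of \<open>hinner X Y = - cosh d\<close>.\<close>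

definition hyp_dist :: "real^3 \<Rightarrow> real^3 \<Rightarrow> real" where
  "hyp_dist X Y = arcosh (- hinner X Y)"

definition phase_space :: "((real^3) \<times> (real^3)) set" where
  "phase_space = {(X\<^sub>1, X\<^sub>2). X\<^sub>1 \<in> hyp_plane \<and> X\<^sub>2 \<in> hyp_plane \<and> X\<^sub>1 \<noteq> X\<^sub>2}"

definition vortex_field :: "real \<Rightarrow> real \<Rightarrow> (real^3) \<times> (real^3) \<Rightarrow> (real^3) \<times> (real^3)" where
  "vortex_field \<Gamma>\<^sub>1 \<Gamma>\<^sub>2 = (\<lambda>(X\<^sub>1, X\<^sub>2).
     ((1 / pi * (\<Gamma>\<^sub>2 / ((hinner X\<^sub>1 X\<^sub>2)\<^sup>2 - 1))) *\<^sub>R hcross X\<^sub>2 X\<^sub>1,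
      (1 / pi * (\<Gamma>\<^sub>1 / ((hinner X\<^sub>2 X\<^sub>1)\<^sup>2 - 1))) *\<^sub>R hcross X\<^sub>1 X\<^sub>2))"

definition momentum :: "real \<Rightarrow> real \<Rightarrow> (real^3) \<times> (real^3) \<Rightarrow> real^3" where
  "momentum \<Gamma>\<^sub>1 \<Gamma>\<^sub>2 = (\<lambda>(X\<^sub>1, X\<^sub>2). \<Gamma>\<^sub>1 *\<^sub>R X\<^sub>1 + \<Gamma>\<^sub>2 *\<^sub>R X\<^sub>2)"

definition momentum_level :: "real \<Rightarrow> real \<Rightarrow> real^3 \<Rightarrow> ((real^3) \<times> (real^3)) set" where
  "momentum_level \<Gamma>\<^sub>1 \<Gamma>\<^sub>2 \<mu> = {X \<in> phase_space. momentum \<Gamma>\<^sub>1 \<Gamma>\<^sub>2 X = \<mu>}"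

text \<open>Integral curves on arbitrary open time intervals. Quantifying over all of them is the
  same as quantifying over the maximal ones, and does not presuppose that the flow is complete.\<close>

definition trajectory ::
  "real \<Rightarrow> real \<Rightarrow> real set \<Rightarrow> (real \<Rightarrow> (real^3) \<times> (real^3)) \<Rightarrow> bool" where
  "trajectory \<Gamma>\<^sub>1 \<Gamma>\<^sub>2 T \<phi> \<longleftrightarrow>
     open T \<and> is_interval T \<and>
     (\<forall>t\<in>T. \<phi> t \<in> phase_space \<and>
        (\<phi> has_vector_derivative vortex_field \<Gamma>\<^sub>1 \<Gamma>\<^sub>2 (\<phi> t)) (at t))"

definition SL2 :: "(real^2^2) set" where
  "SL2 = {g. det g = 1}"

definition sl2_matrix :: "real^3 \<Rightarrow> real^2^2" where
  "sl2_matrix X = vector [vector [X$1, X$2 + X$3], vector [X$2 - X$3, - X$1]]"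

definition sl2_act :: "real^2^2 \<Rightarrow> real^3 \<Rightarrow> real^3" where
  "sl2_act g X = inv sl2_matrix (g ** sl2_matrix X ** matrix_inv g)"

text \<open>The range of \<^const>\<open>sl2_matrix\<close> is the set of trace-free matrices, which is closed under
  conjugation; hence the inverse in \<^const>\<open>sl2_act\<close> is always applied inside that range.\<close>

lemma inj_sl2_matrix: "inj sl2_matrix"
proof (rule injI)
  fix X Y :: "real^3"
  assume "sl2_matrix X = sl2_matrix Y"
  then have "X$1 = Y$1" "X$2 + X$3 = Y$2 + Y$3" "X$2 - X$3 = Y$2 - Y$3"
    by (simp_all add: sl2_matrix_def vec_eq_iff forall_2)
  then have "X$1 = Y$1" "X$2 = Y$2" "X$3 = Y$3"
    by linarith+
  then show "X = Y"
    by (simp add: vec_eq_iff forall_3)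
qed

lemma range_sl2_matrix: "range sl2_matrix = {A. trace A = 0}"
proof (intro equalityI subsetI)
  fix A assume "A \<in> range sl2_matrix"
  then show "A \<in> {A. trace A = 0}"
    by (auto simp: sl2_matrix_def trace_def sum_2)
next
  fix A :: "real^2^2" assume "A \<in> {A. trace A = 0}"
  then have "A$2$2 = - A$1$1"
    by (simp add: trace_def sum_2 add_eq_0_iff)
  then have "A = sl2_matrix (vector [A$1$1, (A$1$2 + A$2$1) / 2, (A$1$2 - A$2$1) / 2])"
    by (simp add: sl2_matrix_def vec_eq_iff forall_2 field_simps)
  then show "A \<in> range sl2_matrix"
    by blast
qed

lemma sl2_matrix_act:
  assumes "g \<in> SL2"
  shows "sl2_matrix (sl2_act g X) = g ** sl2_matrix X ** matrix_inv g"
proof -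
  have "invertible g"
    using assms by (simp add: SL2_def invertible_det_nz)
  then have "matrix_inv g ** g = mat 1"
    unfolding invertible_def matrix_inv_def by (rule someI2_ex) simp
  then have "trace (g ** sl2_matrix X ** matrix_inv g) = trace (sl2_matrix X)"
    by (metis matrix_mul_assoc matrix_mul_lid trace_mul_sym)
  also have "\<dots> = 0"
    using range_sl2_matrix by blast
  finally show ?thesis
    by (simp add: sl2_act_def f_inv_into_f range_sl2_matrix)
qed

definition sl2_act_pair :: "real^2^2 \<Rightarrow> (real^3) \<times> (real^3) \<Rightarrow> (real^3) \<times> (real^3)" where
  "sl2_act_pair g = map_prod (sl2_act g) (sl2_act g)"

definition SL2_isotropy :: "real^3 \<Rightarrow> (real^2^2) set" where
  "SL2_isotropy \<mu> = {g \<in> SL2. sl2_act g \<mu> = \<mu>}"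

definition relative_equilibrium :: "real \<Rightarrow> real \<Rightarrow> (real^3) \<times> (real^3) \<Rightarrow> bool" where
  "relative_equilibrium \<Gamma>\<^sub>1 \<Gamma>\<^sub>2 X \<longleftrightarrow>
     X \<in> phase_space \<and>
     (\<forall>T \<phi>. trajectory \<Gamma>\<^sub>1 \<Gamma>\<^sub>2 T \<phi> \<and> X \<in> \<phi> ` T \<longrightarrow> \<phi> ` T \<subseteq> (\<lambda>g. sl2_act_pair g X) ` SL2)"

definition invariant_nbhd ::
  "(real^2^2) set \<Rightarrow> ((real^3) \<times> (real^3)) set \<Rightarrow> (real^3) \<times> (real^3) \<Rightarrow> ((real^3) \<times> (real^3)) set \<Rightarrow> bool" where
  "invariant_nbhd G P X V \<longleftrightarrow>
     openin (top_of_set P) V \<and> X \<in> V \<and> (\<forall>g\<in>G. sl2_act_pair g ` V \<subseteq> V)"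

definition stable_within ::
  "real \<Rightarrow> real \<Rightarrow> ((real^3) \<times> (real^3)) set \<Rightarrow> (real^2^2) set \<Rightarrow> (real^3) \<times> (real^3) \<Rightarrow> bool" where
  "stable_within \<Gamma>\<^sub>1 \<Gamma>\<^sub>2 P G X \<longleftrightarrow>
     relative_equilibrium \<Gamma>\<^sub>1 \<Gamma>\<^sub>2 X \<and>
     (\<forall>V. invariant_nbhd G P X V \<longrightarrow>
        (\<exists>U. invariant_nbhd G P X U \<and>
          (\<forall>T \<phi>. trajectory \<Gamma>\<^sub>1 \<Gamma>\<^sub>2 T \<phi> \<and> \<phi> ` T \<inter> U \<noteq> {} \<longrightarrow> \<phi> ` T \<subseteq> V)))"

definition G_stable ::
  "real \<Rightarrow> real \<Rightarrow> (real^2^2) set \<Rightarrow> (real^3) \<times> (real^3) \<Rightarrow> bool" where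
  "G_stable \<Gamma>\<^sub>1 \<Gamma>\<^sub>2 G X \<longleftrightarrow> stable_within \<Gamma>\<^sub>1 \<Gamma>\<^sub>2 phase_space G X"

text \<open>A trajectory meeting the level set is not assumed to stay in it: this is part of what
  \<^const>\<open>stable_within\<close> asserts, since \<open>V\<close> is a subset of the level set.\<close>

definition leafwise_stable :: "real \<Rightarrow> real \<Rightarrow> (real^3) \<times> (real^3) \<Rightarrow> bool" where
  "leafwise_stable \<Gamma>\<^sub>1 \<Gamma>\<^sub>2 X \<longleftrightarrow>
     (let \<mu> = momentum \<Gamma>\<^sub>1 \<Gamma>\<^sub>2 X
      in stable_within \<Gamma>\<^sub>1 \<Gamma>\<^sub>2 (momentum_level \<Gamma>\<^sub>1 \<Gamma>\<^sub>2 \<mu>) (SL2_isotropy \<mu>) X)"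

end

(* Write q for the Minkowski square of the momentum value \<mu>. Equal momenta force equal distances,
   and SL(2,R) is transitive on pairs of points at a given distance, so the level sets of the momentum
   map are single orbits of the isotropy group of \<mu>; this gives leafwise stability. The stability
   condition on c says exactly that \<mu> is timelike (q < 0). The momentum map is proper over the timelike
   vectors, so level sets of nearby momenta stay in any invariant neighbourhood of the given one. If
   q >= 0, arbitrarily small perturbations have a spacelike momentum with a different axis, and their
   trajectories, orbits of a one-parameter group of boosts, leave every tube around the level set. *)

theory Submission
  imports Defs
begin

section \<open>The Minkowski form and momentum\<close>

lemmas hvec_defs = hinner_def hcross_def vec_eq_iff forall_3

lemma hinner_commute: "hinner X Y = hinner Y X"
  by (simp add: hinner_def mult.commute)

lemma hinner_linear [simp]:
  "hinner (X + Y) Z = hinner X Z + hinner Y Z" "hinner Z (X + Y) = hinner Z X + hinner Z Y"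
  "hinner (X - Y) Z = hinner X Z - hinner Y Z" "hinner Z (X - Y) = hinner Z X - hinner Z Y"
  "hinner (a *\<^sub>R X) Z = a * hinner X Z" "hinner Z (a *\<^sub>R X) = a * hinner Z X"
  "hinner (- X) Z = - hinner X Z" "hinner Z (- X) = - hinner Z X"
  by (simp_all add: hinner_def algebra_simps)

lemma hcross_linear [simp]:
  "hcross (X + Y) Z = hcross X Z + hcross Y Z" "hcross Z (X + Y) = hcross Z X + hcross Z Y"
  "hcross (X - Y) Z = hcross X Z - hcross Y Z" "hcross Z (X - Y) = hcross Z X - hcross Z Y"
  "hcross (a *\<^sub>R X) Z = a *\<^sub>R hcross X Z" "hcross Z (a *\<^sub>R X) = a *\<^sub>R hcross Z X"
  by (simp_all add: hvec_defs algebra_simps)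

lemma hcross_self [simp]: "hcross X X = 0" "hcross 0 X = 0" "hcross X 0 = 0"
  by (simp_all add: hvec_defs)

lemma hcross_antisym: "hcross Y X = - hcross X Y"
  by (simp add: hvec_defs)

text \<open>Both sides are the determinant of the three vectors: the sign change in the last entry
  of \<open>hcross\<close> cancels the one in \<open>hinner\<close>.\<close>

lemma hinner_hcross_cycle: "hinner (hcross X Y) Z = hinner (hcross Y Z) X"
  by (simp add: hvec_defs algebra_simps)

lemma hinner_hcross_self [simp]:
  "hinner (hcross X Y) X = 0" "hinner (hcross X Y) Y = 0"
  "hinner X (hcross X Y) = 0" "hinner Y (hcross X Y) = 0"
  by (simp_all add: hvec_defs algebra_simps)

lemma hinner_hcross_skew: "hinner (hcross n X) Y = - hinner X (hcross n Y)"
  by (simp add: hvec_defs algebra_simps)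

text \<open>The Lorentzian triple product, with the opposite sign to the Euclidean one.\<close>

lemma hcross_hcross: "hcross X (hcross Y Z) = hinner X Y *\<^sub>R Z - hinner X Z *\<^sub>R Y"
  by (simp add: hvec_defs algebra_simps)

lemma hinner_hcross_norm:
  "hinner (hcross X Y) (hcross X Y) = (hinner X Y)\<^sup>2 - hinner X X * hinner Y Y"
  by (simp add: hvec_defs) algebra

lemma tendsto_hinner [tendsto_intros]:
  assumes "(f \<longlongrightarrow> a) F" "(g \<longlongrightarrow> b) F"
  shows "((\<lambda>x. hinner (f x) (g x)) \<longlongrightarrow> hinner a b) F"
  unfolding hinner_def by (intro tendsto_intros assms)

lemma continuous_on_hinner [continuous_intros]:
  assumes "continuous_on S f" "continuous_on S g"
  shows "continuous_on S (\<lambda>x. hinner (f x) (g x))"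
  using assms by (auto simp: continuous_on_def intro: tendsto_hinner)

section \<open>The upper sheet of the hyperboloid\<close>

lemma hyp_plane_self: "X \<in> hyp_plane \<Longrightarrow> hinner X X = -1"
  by (simp add: hyp_plane_def hinner_def power2_eq_square)

text \<open>The reversed Cauchy-Schwarz inequality. The excess of \<open>(X$3 * Y$3)\<^sup>2\<close>
  over \<open>s\<^sup>2\<close> is the sum of squares \<open>e\<close>, which vanishes only for
  \<open>X = Y\<close>.\<close>

lemma hinner_hyp_plane:
  assumes "X \<in> hyp_plane" "Y \<in> hyp_plane"
  shows "hinner X Y \<le> -1" and "X \<noteq> Y \<Longrightarrow> hinner X Y < -1"
proof -
  define s where "s = 1 + X$1 * Y$1 + X$2 * Y$2"
  define e where "e = (X$1 - Y$1)\<^sup>2 + (X$2 - Y$2)\<^sup>2 + (X$1 * Y$2 - X$2 * Y$1)\<^sup>2"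
  have x: "(X$3)\<^sup>2 = 1 + (X$1)\<^sup>2 + (X$2)\<^sup>2" "X$3 > 0"
    and y: "(Y$3)\<^sup>2 = 1 + (Y$1)\<^sup>2 + (Y$2)\<^sup>2" "Y$3 > 0"
    using assms by (auto simp: hyp_plane_def)
  have sq: "(X$3 * Y$3)\<^sup>2 = s\<^sup>2 + e"
    unfolding power_mult_distrib x(1) y(1) s_def e_def by algebra
  have "e \<ge> 0" by (simp add: e_def)
  have pos: "0 \<le> X$3 * Y$3" using x(2) y(2) by simp
  have "s\<^sup>2 \<le> (X$3 * Y$3)\<^sup>2" using sq \<open>e \<ge> 0\<close> by linarith
  then have "s \<le> X$3 * Y$3"
    using pos by (rule power2_le_imp_le)
  then show "hinner X Y \<le> -1"
    by (simp add: hinner_def s_def)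
  assume "X \<noteq> Y"
  have "e \<noteq> 0"
  proof
    assume "e = 0"
    then have "X$1 = Y$1" "X$2 = Y$2"
      unfolding e_def by (simp_all add: add_nonneg_eq_0_iff)
    moreover from this have "(X$3)\<^sup>2 = (Y$3)\<^sup>2"
      using x(1) y(1) by simp
    then have "X$3 = Y$3"
      using x(2) y(2) by (simp add: power2_eq_iff)
    ultimately show False
      using \<open>X \<noteq> Y\<close> by (simp add: vec_eq_iff forall_3)
  qed
  then have "s\<^sup>2 < (X$3 * Y$3)\<^sup>2" using sq \<open>e \<ge> 0\<close> by linarith
  then have "s < X$3 * Y$3"
    using pos by (rule power2_less_imp_less)
  then show "hinner X Y < -1"
    by (simp add: hinner_def s_def)
qed

text \<open>Otherwise \<open>- Y\<close> would lie on the upper sheet and also have negative pairing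
  with \<open>X\<close>.\<close>

lemma hyp_plane_same_sheet:
  assumes "X \<in> hyp_plane" "hinner Y Y = -1" "hinner X Y < 0"
  shows "Y \<in> hyp_plane"
proof -
  have eq: "(Y$3)\<^sup>2 - (Y$1)\<^sup>2 - (Y$2)\<^sup>2 = 1"
    using assms(2) by (simp add: hinner_def power2_eq_square)
  have "Y$3 > 0"
  proof (rule ccontr)
    assume "\<not> Y$3 > 0"
    moreover have "Y$3 \<noteq> 0"
      using eq by (smt (verit) zero_le_power2 power_zero_numeral)
    ultimately have "- Y \<in> hyp_plane"
      using eq by (simp add: hyp_plane_def)
    with hinner_hyp_plane(1)[OF assms(1) this] assms(3) show False by simp
  qed
  with eq show ?thesis by (simp add: hyp_plane_def)
qed

section \<open>Pairs of distinct points and conservation of momentum\<close>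

lemma phase_spaceD:
  assumes "(X, Y) \<in> phase_space"
  shows "hinner X X = -1" "hinner Y Y = -1" "hinner X Y < -1"
  using assms hyp_plane_self hinner_hyp_plane(2) by (auto simp: phase_space_def)

lemma phase_spaceI:
  assumes "X \<in> hyp_plane" "Y \<in> hyp_plane" "hinner X Y < -1"
  shows "(X, Y) \<in> phase_space"
  using assms hyp_plane_self by (auto simp: phase_space_def)

lemma hinner_momentum:
  assumes "(X, Y) \<in> phase_space"
  shows "hinner (momentum a b (X, Y)) (momentum a b (X, Y)) = 2 * a * b * hinner X Y - a\<^sup>2 - b\<^sup>2"
  using phase_spaceD[OF assms]
  by (simp add: momentum_def hinner_commute[of Y X] power2_eq_square algebra_simps)

text \<open>The Minkowski square of the momentum is affine in \<open>hinner X Y\<close> with nonzero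
  slope \<open>2 * a * b\<close>.\<close>

lemma momentum_eq_imp_hinner_eq:
  assumes "(X, Y) \<in> phase_space" "(X', Y') \<in> phase_space" "a \<noteq> 0" "b \<noteq> 0"
    and "momentum a b (X, Y) = momentum a b (X', Y')"
  shows "hinner X Y = hinner X' Y'"
  using hinner_momentum[OF assms(1), of a b] hinner_momentum[OF assms(2), of a b] assms(3-5) by simp

text \<open>By linearity, the derivative of the momentum is its value on the vortex field, where the
  two terms are opposite multiples of \<open>hcross X Y\<close>.\<close>

lemma trajectory_momentum:
  assumes "trajectory a b T \<phi>" "s \<in> T" "t \<in> T"
  shows "momentum a b (\<phi> s) = momentum a b (\<phi> t)"
proof -
  have "((\<lambda>t. momentum a b (\<phi> t)) has_vector_derivative 0) (at t within T)" if "t \<in> T" for t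
  proof -
    obtain X Y where XY: "\<phi> t = (X, Y)" by (cases "\<phi> t")
    have d: "(\<phi> has_vector_derivative vortex_field a b (X, Y)) (at t within T)"
      using assms(1) that XY unfolding trajectory_def
      by (metis has_vector_derivative_at_within)
    have bl: "bounded_linear (momentum a b)"
      unfolding momentum_def case_prod_beta
      by (intro bounded_linear_add bounded_linear_scaleR_right[THEN bounded_linear_compose]
          bounded_linear_fst bounded_linear_snd)
    have "momentum a b (vortex_field a b (X, Y)) = 0"
      by (simp add: momentum_def vortex_field_def hcross_antisym[of Y X] hinner_commute[of Y X])
    with bounded_linear.has_vector_derivative[OF bl d] show ?thesis by simp
  qed
  then have "\<exists>k. \<forall>t\<in>T. momentum a b (\<phi> t) = k"
    using assms(1) unfolding trajectory_def
    by (metis has_vector_derivative_zero_constant is_interval_convex)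
  with assms(2,3) show ?thesis by metis
qed

section \<open>The action of SL(2,R)\<close>

lemma SL2_matrix_inv:
  assumes "g \<in> SL2"
  shows "g ** matrix_inv g = mat 1" "matrix_inv g ** g = mat 1"
proof -
  have "invertible g"
    using assms by (simp add: SL2_def invertible_det_nz)
  then have "g ** matrix_inv g = mat 1 \<and> matrix_inv g ** g = mat 1"
    unfolding invertible_def matrix_inv_def by (rule someI_ex)
  then show "g ** matrix_inv g = mat 1" "matrix_inv g ** g = mat 1" by auto
qed

lemma SL2_mult: "g \<in> SL2 \<Longrightarrow> h \<in> SL2 \<Longrightarrow> g ** h \<in> SL2"
  by (simp add: SL2_def det_mul)

lemma SL2_inv:
  assumes "g \<in> SL2" shows "matrix_inv g \<in> SL2"
proof -
  have "det g * det (matrix_inv g) = 1"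
    using SL2_matrix_inv(1)[OF assms] by (metis det_I det_mul)
  then show ?thesis using assms by (simp add: SL2_def)
qed

text \<open>Clearing the inverse matrix turns claims about the action into polynomial identities
  between matrix entries.\<close>

lemma sl2_act_eq_iff:
  assumes "g \<in> SL2"
  shows "sl2_act g X = Y \<longleftrightarrow> g ** sl2_matrix X = sl2_matrix Y ** g"
proof
  assume "sl2_act g X = Y"
  then show "g ** sl2_matrix X = sl2_matrix Y ** g"
    by (metis sl2_matrix_act assms SL2_matrix_inv(2) matrix_mul_assoc matrix_mul_rid)
next
  assume "g ** sl2_matrix X = sl2_matrix Y ** g"
  then have "sl2_matrix (sl2_act g X) = sl2_matrix Y"
    by (metis sl2_matrix_act assms SL2_matrix_inv(1) matrix_mul_assoc matrix_mul_rid)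
  then show "sl2_act g X = Y" using inj_sl2_matrix by (simp add: inj_eq)
qed

lemma sl2_act_mult:
  assumes "g \<in> SL2" "h \<in> SL2"
  shows "sl2_act (g ** h) X = sl2_act g (sl2_act h X)"
proof -
  have "h ** sl2_matrix X = sl2_matrix (sl2_act h X) ** h"
    "g ** sl2_matrix (sl2_act h X) = sl2_matrix (sl2_act g (sl2_act h X)) ** g"
    using assms sl2_act_eq_iff by auto
  then show ?thesis
    using assms by (metis sl2_act_eq_iff SL2_mult matrix_mul_assoc)
qed

lemma sl2_act_inv:
  assumes "g \<in> SL2"
  shows "sl2_act (matrix_inv g) (sl2_act g X) = X" "sl2_act g (sl2_act (matrix_inv g) X) = X"
proof -
  have "sl2_act (mat 1) X = X"
    by (simp add: sl2_act_eq_iff SL2_def)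
  then show "sl2_act (matrix_inv g) (sl2_act g X) = X" "sl2_act g (sl2_act (matrix_inv g) X) = X"
    using assms by (simp_all add: sl2_act_mult[symmetric] SL2_inv SL2_matrix_inv)
qed

lemmas matrix_2_defs = sl2_matrix_def matrix_matrix_mult_def mat_def sum_2 vec_eq_iff forall_2

lemma sl2_matrix_linear:
  "sl2_matrix (a *\<^sub>R X + b *\<^sub>R Y) = a *\<^sub>R sl2_matrix X + b *\<^sub>R sl2_matrix Y"
  by (simp add: sl2_matrix_def vec_eq_iff forall_2 algebra_simps)

lemma sl2_act_linear:
  assumes "g \<in> SL2"
  shows "sl2_act g (a *\<^sub>R X + b *\<^sub>R Y) = a *\<^sub>R sl2_act g X + b *\<^sub>R sl2_act g Y"
proof -
  have "g ** sl2_matrix X = sl2_matrix (sl2_act g X) ** g"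
    "g ** sl2_matrix Y = sl2_matrix (sl2_act g Y) ** g"
    using assms sl2_act_eq_iff by auto
  moreover have "g ** (a *\<^sub>R A + b *\<^sub>R B) = a *\<^sub>R (g ** A) + b *\<^sub>R (g ** B)"
    "(a *\<^sub>R A + b *\<^sub>R B) ** g = a *\<^sub>R (A ** g) + b *\<^sub>R (B ** g)" for A B :: "real^2^2"
    by (simp_all add: matrix_2_defs algebra_simps)
  ultimately show ?thesis
    by (simp add: sl2_act_eq_iff assms sl2_matrix_linear)
qed

text \<open>The Minkowski form is half the trace form, and conjugation preserves traces of
  products.\<close>

lemma trace_sl2_matrix: "trace (sl2_matrix X ** sl2_matrix Y) = 2 * hinner X Y"
  by (simp add: trace_def matrix_2_defs hinner_def algebra_simps)

lemma hinner_sl2_act: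
  assumes "g \<in> SL2"
  shows "hinner (sl2_act g X) (sl2_act g Y) = hinner X Y"
proof -
  let ?A = "sl2_matrix X" and ?B = "sl2_matrix Y" and ?h = "matrix_inv g"
  have "trace (sl2_matrix (sl2_act g X) ** sl2_matrix (sl2_act g Y)) = trace (g ** ?A ** ?h ** (g ** ?B ** ?h))"
    by (simp add: sl2_matrix_act assms)
  also have "g ** ?A ** ?h ** (g ** ?B ** ?h) = g ** (?A ** (?h ** g) ** ?B ** ?h)"
    by (simp only: matrix_mul_assoc)
  also have "trace \<dots> = trace (?A ** ?B ** (?h ** g))"
    by (subst trace_mul_sym) (simp add: matrix_mul_assoc[symmetric] SL2_matrix_inv assms)
  also have "\<dots> = trace (?A ** ?B)"
    by (simp add: SL2_matrix_inv assms)
  finally show ?thesis by (simp add: trace_sl2_matrix)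
qed

text \<open>The form has determinant \<open>p * r - x\<^sup>2 = 1\<close> and a positive corner
  entry; multiplying it by \<open>p\<close> completes the square.\<close>

lemma quadratic_form_pos:
  fixes p r x a b :: real
  assumes "p > 0" "p * r = 1 + x\<^sup>2" "a \<noteq> 0 \<or> b \<noteq> 0"
  shows "a\<^sup>2 * p - 2 * a * b * x + b\<^sup>2 * r > 0"
proof -
  have "p * (a\<^sup>2 * p - 2 * a * b * x + b\<^sup>2 * r) = (a * p - b * x)\<^sup>2 + b\<^sup>2 * (p * r - x\<^sup>2)"
    by algebra
  also have "\<dots> = (a * p - b * x)\<^sup>2 + b\<^sup>2"
    using assms(2) by simp
  also have "\<dots> > 0"
    using assms(1,3) by (cases "b = 0") (auto intro: add_nonneg_pos)
  finally show ?thesis using assms(1) by (simp add: zero_less_mult_iff)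
qed

text \<open>Up to the constant factor \<open>sl2_matrix (vector [0, 0, 1])\<close>, the action is the congruence
  action on symmetric matrices, which preserves positive definiteness.\<close>

lemma hyp_plane_sl2_act:
  assumes "g \<in> SL2" "X \<in> hyp_plane"
  shows "sl2_act g X \<in> hyp_plane"
proof -
  let ?Y = "sl2_act g X"
  define p r where "p = X$2 + X$3" and "r = X$3 - X$2"
  have norm: "(X$3)\<^sup>2 - (X$1)\<^sup>2 - (X$2)\<^sup>2 = 1" "X$3 > 0"
    using assms(2) by (auto simp: hyp_plane_def)
  then have pr: "p * r = 1 + (X$1)\<^sup>2"
    unfolding p_def r_def by algebra
  then have "p * r > 0" by (simp add: add_pos_nonneg)
  moreover have "p + r > 0" using norm by (simp add: p_def r_def)
  ultimately have "p > 0" by (smt (verit) zero_less_mult_iff)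
  have det: "g$1$1 * g$2$2 - g$1$2 * g$2$1 = 1"
    using assms(1) by (simp add: SL2_def det_2)
  have "g ** sl2_matrix X = sl2_matrix ?Y ** g"
    using assms(1) sl2_act_eq_iff by auto
  then have e: "g$1$1 * X$1 + g$1$2 * (X$2 - X$3) = ?Y$1 * g$1$1 + (?Y$2 + ?Y$3) * g$2$1"
    "g$1$1 * (X$2 + X$3) - g$1$2 * X$1 = ?Y$1 * g$1$2 + (?Y$2 + ?Y$3) * g$2$2"
    "g$2$1 * X$1 + g$2$2 * (X$2 - X$3) = (?Y$2 - ?Y$3) * g$1$1 - ?Y$1 * g$2$1"
    "g$2$1 * (X$2 + X$3) - g$2$2 * X$1 = (?Y$2 - ?Y$3) * g$1$2 - ?Y$1 * g$2$2"
    by (simp_all add: matrix_2_defs)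
  \<comment> \<open>Up to sign, the off-diagonal entries of the conjugated matrix are the values of
    this form at the two rows of \<open>g\<close>, which are nonzero since
    \<open>det g = 1\<close>.\<close>
  have "?Y$2 + ?Y$3 = (g$1$1)\<^sup>2 * p - 2 * g$1$1 * g$1$2 * X$1 + (g$1$2)\<^sup>2 * r"
    using e(1,2) det unfolding p_def r_def by algebra
  also have "\<dots> > 0"
    using det by (intro quadratic_form_pos[OF \<open>p > 0\<close> pr]) auto
  finally have 1: "?Y$2 + ?Y$3 > 0" .
  have "?Y$3 - ?Y$2 = (g$2$1)\<^sup>2 * p - 2 * g$2$1 * g$2$2 * X$1 + (g$2$2)\<^sup>2 * r"
    using e(3,4) det unfolding p_def r_def by algebra
  also have "\<dots> > 0"
    using det by (intro quadratic_form_pos[OF \<open>p > 0\<close> pr]) auto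
  finally have 2: "?Y$3 - ?Y$2 > 0" .
  have "hinner ?Y ?Y = -1"
    using hinner_sl2_act[OF assms(1)] hyp_plane_self[OF assms(2)] by simp
  with 1 2 show ?thesis
    by (simp add: hyp_plane_def hinner_def power2_eq_square)
qed

lemma phase_space_sl2_act_pair:
  assumes "g \<in> SL2" "X \<in> phase_space"
  shows "sl2_act_pair g X \<in> phase_space"
proof -
  obtain X1 X2 where "X = (X1, X2)" by (cases X)
  then show ?thesis
    using assms hyp_plane_sl2_act[OF assms(1)] sl2_act_inv(1)[OF assms(1)]
    by (auto simp: phase_space_def sl2_act_pair_def) metis
qed

lemma momentum_sl2_act_pair:
  "g \<in> SL2 \<Longrightarrow> momentum a b (sl2_act_pair g X) = sl2_act g (momentum a b X)"
  by (cases X) (simp add: momentum_def sl2_act_pair_def sl2_act_linear)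

text \<open>As \<open>sl2_matrix X ** sl2_matrix X = - mat 1\<close> on the hyperbolic plane, \<open>mat 1 - B ** A\<close>
  intertwines \<open>A = sl2_matrix X\<close> and \<open>B = sl2_matrix Y\<close>.\<close>

lemma SL2_transitive:
  assumes "X \<in> hyp_plane" "Y \<in> hyp_plane"
  obtains g where "g \<in> SL2" "sl2_act g X = Y"
proof -
  \<comment> \<open>Both matrices have determinant 1 and their product has trace
    \<open>2 * hinner X Y\<close>, so \<open>d\<close> is the determinant of the intertwiner; the
    factor \<open>r\<close> rescales it to 1.\<close>
  define d where "d = 2 - 2 * hinner X Y"
  define r where "r = 1 / sqrt d"
  have "d > 0" using hinner_hyp_plane(1)[OF assms] by (simp add: d_def)
  then have r: "r * r * d = 1" by (simp add: r_def)
  have x: "X$1 * X$1 + X$2 * X$2 - X$3 * X$3 = -1" and y: "Y$1 * Y$1 + Y$2 * Y$2 - Y$3 * Y$3 = -1"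
    using assms[THEN hyp_plane_self] by (simp_all add: hinner_def)
  define g where "g = r *\<^sub>R (mat 1 - sl2_matrix Y ** sl2_matrix X)"
  have "det g = r * r * d"
    using x y unfolding det_2 g_def d_def hinner_def
    by (simp add: matrix_2_defs) algebra
  with r have g: "g \<in> SL2" by (simp add: SL2_def)
  have "g ** sl2_matrix X = sl2_matrix Y ** g"
    using x y unfolding g_def by (simp add: matrix_2_defs) algebra
  with g show thesis using that by (simp add: sl2_act_eq_iff)
qed

text \<open>The matrices commuting with \<open>A = sl2_matrix X\<close> are \<open>\<alpha> mat 1 + \<beta> A\<close>; such a matrix carries
  \<open>P\<close> to \<open>Q\<close> iff \<open>\<alpha> (P - Q) = \<beta> hcross X (P + Q)\<close>.\<close>

lemma SL2_isotropy_transitive: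
  assumes "X \<in> hyp_plane" "P \<in> hyp_plane" "Q \<in> hyp_plane" "hinner X P = hinner X Q"
  obtains g where "g \<in> SL2" "sl2_act g X = X" "sl2_act g P = Q"
proof -
  define W where "W = P - Q"
  define N where "N = hcross X (P + Q)"
  \<comment> \<open>The first equation makes the determinant of
    \<open>\<alpha> *\<^sub>R mat 1 + \<beta> *\<^sub>R sl2_matrix X\<close> equal to 1.\<close>
  have "\<exists>\<alpha> \<beta>. \<alpha>\<^sup>2 + \<beta>\<^sup>2 = 1 \<and> \<alpha> *\<^sub>R W = \<beta> *\<^sub>R N"
  proof (cases "N = 0")
    case True
    \<comment> \<open>Here \<open>P + Q\<close> is a multiple of \<open>X\<close>, and the half-turn
      about \<open>X\<close>, given by \<open>sl2_matrix X\<close> itself, carries \<open>P\<close>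
      to \<open>Q\<close>.\<close>
    then show ?thesis by (intro exI[of _ 0] exI[of _ 1]) simp
  next
    case False
    have PQ: "hinner W X = 0" "hinner W (P + Q) = 0"
      using assms(4) hyp_plane_self[OF assms(2)] hyp_plane_self[OF assms(3)]
      by (simp_all add: W_def hinner_commute)
    \<comment> \<open>By the triple product, the two pairings of \<open>W\<close> are the
      coefficients of \<open>hcross W N\<close>. So \<open>W\<close> is a multiple of
      \<open>N\<close> once \<open>N\<close> is known not to be null.\<close>
    then have "hcross W N = 0" by (simp add: N_def hcross_hcross del: hinner_linear hcross_linear)
    then have "hcross N (hcross N W) = 0"
      using hcross_antisym[of W N] by simp
    then have W: "hinner N N *\<^sub>R W = hinner N W *\<^sub>R N"
      by (simp add: hcross_hcross)
    \<comment> \<open>A null vector orthogonal to the timelike \<open>X\<close> vanishes: Lagrange's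
      identity in the first two coordinates leaves a vanishing sum of squares containing
      \<open>(N$3)\<^sup>2\<close>.\<close>
    have "hinner N N \<noteq> 0"
    proof
      assume "hinner N N = 0"
      have "hinner N X = 0" by (simp add: N_def del: hinner_linear hcross_linear)
      then have *: "N$1 * X$1 + N$2 * X$2 = N$3 * X$3" by (simp add: hinner_def)
      have nn: "(N$3)\<^sup>2 = (N$1)\<^sup>2 + (N$2)\<^sup>2"
        using \<open>hinner N N = 0\<close> by (simp add: hinner_def power2_eq_square)
      have xx: "(X$3)\<^sup>2 = 1 + (X$1)\<^sup>2 + (X$2)\<^sup>2"
        using assms(1) by (simp add: hyp_plane_def)
      have "(N$1 * X$1 + N$2 * X$2)\<^sup>2 + (N$1 * X$2 - N$2 * X$1)\<^sup>2
          = ((N$1)\<^sup>2 + (N$2)\<^sup>2) * ((X$1)\<^sup>2 + (X$2)\<^sup>2)"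
        by algebra
      also have "\<dots> = (N$3 * X$3)\<^sup>2 - (N$3)\<^sup>2"
        unfolding power_mult_distrib nn xx by algebra
      finally have "(N$3)\<^sup>2 + (N$1 * X$2 - N$2 * X$1)\<^sup>2 = 0"
        by (simp add: *)
      then have "N$3 = 0" by (simp add: add_nonneg_eq_0_iff)
      with nn have "N = 0" by (simp add: vec_eq_iff forall_3 add_nonneg_eq_0_iff)
      with False show False by simp
    qed
    define t where "t = hinner N W / hinner N N"
    have "W = t *\<^sub>R N"
      using W \<open>hinner N N \<noteq> 0\<close>
      by (metis (no_types, lifting) t_def divide_inverse_commute scaleR_one scaleR_scaleR left_inverse)
    moreover define s where "s = 1 / sqrt (1 + t\<^sup>2)"
    have "s\<^sup>2 * (1 + t\<^sup>2) = 1"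
      using add_pos_nonneg[of 1 "t\<^sup>2"] by (simp add: s_def power_divide)
    ultimately show ?thesis
      by (intro exI[of _ s] exI[of _ "s * t"]) (simp add: power_mult_distrib algebra_simps)
  qed
  then obtain \<alpha> \<beta> where ab: "\<alpha> * \<alpha> + \<beta> * \<beta> = 1" "\<alpha> *\<^sub>R W = \<beta> *\<^sub>R N"
    by (auto simp: power2_eq_square)
  have x: "X$1 * X$1 + X$2 * X$2 - X$3 * X$3 = -1"
    using assms(1)[THEN hyp_plane_self] by (simp add: hinner_def)
  define g where "g = \<alpha> *\<^sub>R mat 1 + \<beta> *\<^sub>R sl2_matrix X"
  have "det g = 1"
    using x ab(1) unfolding det_2 g_def by (simp add: matrix_2_defs) algebra
  then have g: "g \<in> SL2" by (simp add: SL2_def)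
  have "g ** sl2_matrix X = sl2_matrix X ** g"
    unfolding g_def by (simp add: matrix_2_defs algebra_simps)
  moreover have "g ** sl2_matrix P = sl2_matrix Q ** g"
    using ab(2) assms(4) unfolding g_def W_def N_def hinner_def
    by (simp add: matrix_2_defs hcross_def forall_3) algebra
  ultimately show thesis using that g by (simp add: sl2_act_eq_iff)
qed

lemma SL2_transitive_pairs:
  assumes "(X1, X2) \<in> phase_space" "(Y1, Y2) \<in> phase_space" "hinner X1 X2 = hinner Y1 Y2"
  obtains g where "g \<in> SL2" "sl2_act_pair g (X1, X2) = (Y1, Y2)"
proof -
  have H: "X1 \<in> hyp_plane" "X2 \<in> hyp_plane" "Y1 \<in> hyp_plane" "Y2 \<in> hyp_plane"
    using assms by (auto simp: phase_space_def)
  obtain h where h: "h \<in> SL2" "sl2_act h X1 = Y1"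
    using SL2_transitive H by metis
  have "hinner Y1 (sl2_act h X2) = hinner Y1 Y2"
    using assms(3) hinner_sl2_act h by metis
  then obtain k where k: "k \<in> SL2" "sl2_act k Y1 = Y1" "sl2_act k (sl2_act h X2) = Y2"
    using SL2_isotropy_transitive H h hyp_plane_sl2_act by metis
  have "sl2_act_pair (k ** h) (X1, X2) = (Y1, Y2)"
    using h k by (simp add: sl2_act_pair_def sl2_act_mult)
  then show thesis using that SL2_mult h k by metis
qed

text \<open>The momentum value determines the distance of the vortices, so two configurations with the
  same momentum differ by an element of \<open>SL2\<close>, which then fixes that momentum.\<close>

lemma momentum_level_orbit:
  assumes "X \<in> phase_space" "Y \<in> phase_space" "a \<noteq> 0" "b \<noteq> 0"
    and "momentum a b X = momentum a b Y"
  obtains g where "g \<in> SL2_isotropy (momentum a b X)" "sl2_act_pair g X = Y"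
proof -
  obtain X1 X2 Y1 Y2 where XY: "X = (X1, X2)" "Y = (Y1, Y2)" by (cases X, cases Y)
  then have "hinner X1 X2 = hinner Y1 Y2"
    using assms momentum_eq_imp_hinner_eq by blast
  then obtain g where g: "g \<in> SL2" "sl2_act_pair g X = Y"
    using SL2_transitive_pairs assms(1,2) XY by metis
  then have "sl2_act g (momentum a b X) = momentum a b X"
    using assms(5) momentum_sl2_act_pair by metis
  with g show thesis using that by (simp add: SL2_isotropy_def)
qed

section \<open>Level sets of the momentum map\<close>

text \<open>The hyperbolic cosine of \<open>ln \<bar>a\<bar> - ln \<bar>b\<bar>\<close> is
  \<open>(a\<^sup>2 + b\<^sup>2) / (2 * \<bar>a\<bar> * \<bar>b\<bar>)\<close>, so applying
  \<open>cosh\<close> to the inequality and clearing denominators gives the Minkowski square of the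
  momentum.\<close>

lemma hyp_dist_less_ln_ratio_iff:
  assumes "(X, Y) \<in> phase_space" "a * b < 0"
  shows "hyp_dist X Y < \<bar>ln \<bar>a\<bar> - ln \<bar>b\<bar>\<bar> \<longleftrightarrow> hinner (momentum a b (X, Y)) (momentum a b (X, Y)) < 0"
proof -
  define l where "l = ln \<bar>a\<bar> - ln \<bar>b\<bar>"
  have ab: "\<bar>a\<bar> > 0" "\<bar>b\<bar> > 0" "a * b = - (\<bar>a\<bar> * \<bar>b\<bar>)"
    using assms(2) by (auto simp: abs_mult[symmetric])
  have "cosh l = cosh (ln (\<bar>a\<bar> / \<bar>b\<bar>))"
    using ab by (simp add: l_def ln_div)
  also have "\<dots> = (\<bar>a\<bar> / \<bar>b\<bar> + \<bar>b\<bar> / \<bar>a\<bar>) / 2"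
    using ab by (subst cosh_ln_real) auto
  finally have l: "2 * (\<bar>a\<bar> * \<bar>b\<bar>) * cosh l = a\<^sup>2 + b\<^sup>2"
    using ab by (simp add: field_simps power2_eq_square)
  have h: "- hinner X Y \<ge> 1"
    using phase_spaceD(3)[OF assms(1)] by simp
  have "hyp_dist X Y < \<bar>l\<bar> \<longleftrightarrow> cosh (hyp_dist X Y) < cosh \<bar>l\<bar>"
    using h by (intro cosh_real_nonneg_less_iff[symmetric]) (auto simp: hyp_dist_def)
  also have "\<dots> \<longleftrightarrow> - hinner X Y < cosh l"
    using h by (simp add: hyp_dist_def)
  also have "\<dots> \<longleftrightarrow> 2 * (\<bar>a\<bar> * \<bar>b\<bar>) * (- hinner X Y) < 2 * (\<bar>a\<bar> * \<bar>b\<bar>) * cosh l"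
    using ab by (intro mult_less_cancel_left_pos[symmetric]) auto
  also have "\<dots> \<longleftrightarrow> hinner (momentum a b (X, Y)) (momentum a b (X, Y)) < 0"
    unfolding hinner_momentum[OF assms(1)] l using ab(3) by (auto simp: mult.assoc)
  finally show ?thesis by (simp add: l_def)
qed

lemma relative_equilibrium_phase_space:
  assumes "X \<in> phase_space" "a \<noteq> 0" "b \<noteq> 0"
  shows "relative_equilibrium a b X"
  unfolding relative_equilibrium_def
proof (intro conjI allI impI subsetI)
  fix T \<phi> Y assume "trajectory a b T \<phi> \<and> X \<in> \<phi> ` T" "Y \<in> \<phi> ` T"
  then have "Y \<in> phase_space" "momentum a b X = momentum a b Y"
    using trajectory_momentum[of a b T \<phi>] by (auto simp: trajectory_def)
  then obtain g where "g \<in> SL2_isotropy (momentum a b X)" "sl2_act_pair g X = Y"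
    using momentum_level_orbit assms by metis
  then show "Y \<in> (\<lambda>g. sl2_act_pair g X) ` SL2"
    by (auto simp: SL2_isotropy_def)
qed (fact assms)

text \<open>The level set is a single orbit of the isotropy group, hence its own only invariant
  neighbourhood of \<open>X\<close>; \<open>U = V\<close> works because the momentum is
  conserved.\<close>

lemma leafwise_stable_phase_space:
  assumes "X \<in> phase_space" "a \<noteq> 0" "b \<noteq> 0"
  shows "leafwise_stable a b X"
proof -
  define \<mu> where "\<mu> = momentum a b X"
  have "stable_within a b (momentum_level a b \<mu>) (SL2_isotropy \<mu>) X"
    unfolding stable_within_def
  proof (intro conjI allI impI)
    show "relative_equilibrium a b X"
      using assms by (rule relative_equilibrium_phase_space)
    fix V assume V: "invariant_nbhd (SL2_isotropy \<mu>) (momentum_level a b \<mu>) X V"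
    have "momentum_level a b \<mu> \<subseteq> V"
    proof
      fix Y assume "Y \<in> momentum_level a b \<mu>"
      then have "Y \<in> phase_space" "momentum a b X = momentum a b Y"
        by (auto simp: momentum_level_def \<mu>_def)
      then obtain g where "g \<in> SL2_isotropy \<mu>" "sl2_act_pair g X = Y"
        using momentum_level_orbit assms \<mu>_def by metis
      with V show "Y \<in> V" by (auto simp: invariant_nbhd_def)
    qed
    moreover have "V \<subseteq> momentum_level a b \<mu>"
      using V openin_imp_subset by (auto simp: invariant_nbhd_def)
    ultimately have VL: "V = momentum_level a b \<mu>" by blast
    have "\<phi> ` T \<subseteq> V" if \<phi>: "trajectory a b T \<phi>" "\<phi> ` T \<inter> V \<noteq> {}" for T \<phi>
    proof -
      obtain s where "s \<in> T" "momentum a b (\<phi> s) = \<mu>"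
        using \<phi>(2) unfolding VL momentum_level_def by blast
      then have "momentum a b (\<phi> t) = \<mu>" if "t \<in> T" for t
        using trajectory_momentum[OF \<phi>(1) that] by simp
      then show ?thesis
        using \<phi>(1) by (auto simp: VL momentum_level_def trajectory_def)
    qed
    with V show "\<exists>U. invariant_nbhd (SL2_isotropy \<mu>) (momentum_level a b \<mu>) X U \<and>
        (\<forall>T \<phi>. trajectory a b T \<phi> \<and> \<phi> ` T \<inter> U \<noteq> {} \<longrightarrow> \<phi> ` T \<subseteq> V)"
      by blast
  qed
  then show ?thesis by (simp add: leafwise_stable_def \<mu>_def)
qed

section \<open>Compactness estimates for timelike momenta\<close>

lemma timelike_gap:
  assumes "hinner n n < 0"
  shows "\<bar>n$3\<bar> - sqrt ((n$1)\<^sup>2 + (n$2)\<^sup>2) > 0"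
proof -
  have "(n$1)\<^sup>2 + (n$2)\<^sup>2 < (n$3)\<^sup>2"
    using assms by (simp add: hinner_def power2_eq_square)
  then have "sqrt ((n$1)\<^sup>2 + (n$2)\<^sup>2) < sqrt ((n$3)\<^sup>2)"
    by (rule real_sqrt_less_mono)
  then show ?thesis by simp
qed

text \<open>Cauchy-Schwarz in the first two coordinates, where \<open>X\<close> has length below
  \<open>X$3\<close>. For timelike \<open>n\<close> the factor on the left is positive, so the
  pairing with \<open>n\<close> controls the height of \<open>X\<close>.\<close>

lemma hinner_timelike_bound:
  assumes "X \<in> hyp_plane"
  shows "(\<bar>n$3\<bar> - sqrt ((n$1)\<^sup>2 + (n$2)\<^sup>2)) * X$3 \<le> \<bar>hinner n X\<bar>"
proof -
  define m where "m = sqrt ((n$1)\<^sup>2 + (n$2)\<^sup>2)"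
  have m: "m\<^sup>2 = (n$1)\<^sup>2 + (n$2)\<^sup>2" "m \<ge> 0" by (auto simp: m_def)
  have X: "(X$3)\<^sup>2 = 1 + (X$1)\<^sup>2 + (X$2)\<^sup>2" "X$3 > 0"
    using assms by (auto simp: hyp_plane_def)
  have "(m * X$3)\<^sup>2 = (n$1 * X$1 + n$2 * X$2)\<^sup>2 + ((n$1 * X$2 - n$2 * X$1)\<^sup>2 + m\<^sup>2)"
    unfolding power_mult_distrib X(1) m(1) by algebra
  then have "\<bar>n$1 * X$1 + n$2 * X$2\<bar>\<^sup>2 \<le> (m * X$3)\<^sup>2"
    by simp
  then have "\<bar>n$1 * X$1 + n$2 * X$2\<bar> \<le> m * X$3"
    using m(2) X(2) by (auto intro: power2_le_imp_le)
  moreover have "\<bar>n$3 * X$3\<bar> = \<bar>n$3\<bar> * X$3"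
    using X(2) by (simp add: abs_mult)
  ultimately show ?thesis
    unfolding m_def[symmetric] hinner_def by (simp add: left_diff_distrib)
qed

lemma norm_hyp_plane:
  assumes "X \<in> hyp_plane" shows "norm X \<le> 3 * X$3"
proof -
  have X: "(X$3)\<^sup>2 = 1 + (X$1)\<^sup>2 + (X$2)\<^sup>2" "X$3 > 0"
    using assms by (auto simp: hyp_plane_def)
  have "\<bar>X$1\<bar>\<^sup>2 \<le> (X$3)\<^sup>2" "\<bar>X$2\<bar>\<^sup>2 \<le> (X$3)\<^sup>2" by (simp_all add: X(1))
  then have "\<bar>X$1\<bar> \<le> X$3" "\<bar>X$2\<bar> \<le> X$3"
    using X(2) by (auto intro: power2_le_imp_le)
  moreover have "norm X \<le> \<bar>X$1\<bar> + \<bar>X$2\<bar> + \<bar>X$3\<bar>"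
    using norm_le_l1_cart[of X] by (simp add: sum_3)
  ultimately show ?thesis using X(2) by simp
qed

text \<open>No point of the two-sheeted hyperboloid has \<open>X$3 = 0\<close>, so the strict
  inequality can be weakened to a closed condition.\<close>

lemma closed_hyp_plane: "closed hyp_plane"
proof -
  have eq: "hyp_plane = {X. hinner X X = -1} \<inter> {X. X$3 \<ge> 0}"
  proof (intro equalityI subsetI)
    fix X assume X: "X \<in> {X. hinner X X = -1} \<inter> {X. X$3 \<ge> 0}"
    then have "(X$3)\<^sup>2 = 1 + (X$1)\<^sup>2 + (X$2)\<^sup>2"
      by (simp add: hinner_def power2_eq_square)
    then have "(X$3)\<^sup>2 > 0" by (simp add: add_pos_nonneg)
    with X have "X$3 > 0" by (simp add: order_le_less)
    with X show "X \<in> hyp_plane"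
      by (simp add: hyp_plane_def hinner_def power2_eq_square)
  next
    fix X assume "X \<in> hyp_plane"
    then show "X \<in> {X. hinner X X = -1} \<inter> {X. X$3 \<ge> 0}"
      using hyp_plane_self by (auto simp: hyp_plane_def)
  qed
  have "closed {X. hinner X X = -1}" "closed {X :: real^3. X$3 \<ge> 0}"
    by (intro closed_Collect_eq closed_Collect_le continuous_intros)+
  then show ?thesis unfolding eq by (rule closed_Int)
qed

lemma tendsto_momentum [tendsto_intros]:
  assumes "(f \<longlongrightarrow> X) F"
  shows "((\<lambda>x. momentum a b (f x)) \<longlongrightarrow> momentum a b X) F"
  unfolding momentum_def case_prod_beta by (intro tendsto_intros assms)

text \<open>Properness of the momentum map over the open set of timelike momenta.\<close>

lemma momentum_timelike_compactness:
  fixes Y Z :: "nat \<Rightarrow> (real^3) \<times> (real^3)"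
  assumes "a \<noteq> 0" "b \<noteq> 0" "Y0 \<in> phase_space" "\<And>n. Y n \<in> phase_space" "\<And>n. Z n \<in> phase_space"
    and "Y \<longlonglongrightarrow> Y0" "\<And>n. momentum a b (Z n) = momentum a b (Y n)"
    and timelike: "hinner (momentum a b Y0) (momentum a b Y0) < 0"
      "\<And>n. hinner (momentum a b (Y n)) (momentum a b (Y n)) < 0"
  obtains Z0 r where "strict_mono (r :: nat \<Rightarrow> nat)" "(Z \<circ> r) \<longlonglongrightarrow> Z0" "Z0 \<in> phase_space"
    "momentum a b Z0 = momentum a b Y0"
proof -
  define \<mu> where "\<mu> n = momentum a b (Y n)" for n
  define h where "h n = hinner (fst (Y n)) (snd (Y n))" for n
  define h0 where "h0 = hinner (fst Y0) (snd Y0)"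
  define gap where "gap m = \<bar>m$3\<bar> - sqrt ((m$1)\<^sup>2 + (m$2)\<^sup>2)" for m :: "real^3"
  have lim_\<mu>: "\<mu> \<longlonglongrightarrow> momentum a b Y0"
    unfolding \<mu>_def by (intro tendsto_intros assms)
  have lim_h: "h \<longlonglongrightarrow> h0"
    unfolding h_def h0_def by (intro tendsto_intros assms)
  have hZ: "hinner (fst (Z n)) (snd (Z n)) = h n" for n
    using momentum_eq_imp_hinner_eq[of "fst (Z n)" "snd (Z n)" "fst (Y n)" "snd (Y n)" a b] assms
    by (simp add: h_def)
  have H: "fst (Z n) \<in> hyp_plane" "snd (Z n) \<in> hyp_plane" for n
    using assms(5)[of n] by (auto simp: phase_space_def)
  have \<mu>_Z: "\<mu> n = a *\<^sub>R fst (Z n) + b *\<^sub>R snd (Z n)" for n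
    unfolding \<mu>_def assms(7)[symmetric] by (simp add: momentum_def case_prod_beta)
  \<comment> \<open>Pairing the momentum with the first vortex gives \<open>b * h n - a\<close>,
    which converges; the heights of the first vortices are therefore bounded.\<close>
  have "gap (\<mu> n) * (fst (Z n))$3 \<le> \<bar>b * h n - a\<bar>" for n
  proof -
    from \<mu>_Z have "hinner (\<mu> n) (fst (Z n)) = b * h n - a"
      using hyp_plane_self[OF H(1)] hZ[of n] by (simp add: hinner_commute)
    then show ?thesis
      using hinner_timelike_bound[OF H(1), of "\<mu> n" n] by (simp add: gap_def)
  qed
  then have bound: "(fst (Z n))$3 \<le> \<bar>b * h n - a\<bar> / gap (\<mu> n)" for n
    using timelike_gap[OF timelike(2)[of n]] by (simp add: \<mu>_def gap_def field_simps)
  have "(\<lambda>n. gap (\<mu> n)) \<longlonglongrightarrow> gap (momentum a b Y0)"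
    unfolding gap_def by (intro tendsto_intros lim_\<mu>)
  moreover have "gap (momentum a b Y0) \<noteq> 0"
    using timelike_gap[OF timelike(1)] by (simp add: gap_def)
  ultimately have "(\<lambda>n. \<bar>b * h n - a\<bar> / gap (\<mu> n)) \<longlonglongrightarrow> \<bar>b * h0 - a\<bar> / gap (momentum a b Y0)"
    by (intro tendsto_intros lim_h)
  then have "Bseq (\<lambda>n. \<bar>b * h n - a\<bar> / gap (\<mu> n))"
    by (intro convergent_imp_Bseq convergentI)
  then obtain K where K: "\<And>n. \<bar>\<bar>b * h n - a\<bar> / gap (\<mu> n)\<bar> \<le> K"
    unfolding Bseq_def by auto
  have "norm (fst (Z n)) \<le> 3 * K" for n
    using norm_hyp_plane[OF H(1), of n] bound[of n] K[of n] by linarith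
  then have "bounded (range (\<lambda>n. fst (Z n)))"
    unfolding bounded_iff by blast
  then obtain A r where r: "strict_mono r" "((\<lambda>n. fst (Z n)) \<circ> r) \<longlonglongrightarrow> A"
    using bounded_imp_convergent_subsequence by blast
  \<comment> \<open>With the momenta and the first vortices convergent, the second vortices converge
    to the solution of the momentum equation.\<close>
  define B where "B = (1 / b) *\<^sub>R (momentum a b Y0 - a *\<^sub>R A)"
  have "snd (Z n) = (1 / b) *\<^sub>R (\<mu> n - a *\<^sub>R fst (Z n))" for n
    using assms(2) by (simp add: \<mu>_Z)
  moreover have "(\<lambda>n. (1 / b) *\<^sub>R (\<mu> (r n) - a *\<^sub>R fst (Z (r n)))) \<longlonglongrightarrow> B"
    unfolding B_def using r(2) LIMSEQ_subseq_LIMSEQ[OF lim_\<mu> r(1)]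
    by (intro tendsto_intros) (auto simp: o_def)
  ultimately have B: "(\<lambda>n. snd (Z (r n))) \<longlonglongrightarrow> B" by simp
  have A: "(\<lambda>n. fst (Z (r n))) \<longlonglongrightarrow> A" using r(2) by (simp add: o_def)
  have "A \<in> hyp_plane" "B \<in> hyp_plane"
    using closed_sequentially[OF closed_hyp_plane _ A] closed_sequentially[OF closed_hyp_plane _ B] H
    by auto
  \<comment> \<open>The limiting pair stays off the diagonal because its pairing is
    \<open>h0 < -1\<close>.\<close>
  moreover have "(\<lambda>n. h (r n)) \<longlonglongrightarrow> hinner A B"
    unfolding hZ[symmetric] by (intro tendsto_intros A B)
  then have "hinner A B = h0"
    using LIMSEQ_subseq_LIMSEQ[OF lim_h r(1)] LIMSEQ_unique by (auto simp: o_def)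
  then have "hinner A B < -1"
    using phase_spaceD(3)[of "fst Y0" "snd Y0"] assms(3) by (simp add: h0_def)
  ultimately have "(A, B) \<in> phase_space" by (rule phase_spaceI)
  moreover have "(Z \<circ> r) \<longlonglongrightarrow> (A, B)"
    using tendsto_Pair[OF A B] by (simp add: o_def)
  moreover have "momentum a b (A, B) = momentum a b Y0"
    using assms(2) by (simp add: momentum_def B_def)
  ultimately show thesis using that r(1) by blast
qed

section \<open>Stability for timelike momentum\<close>

lemma timelike_imp_G_stable:
  assumes "X \<in> phase_space" "a \<noteq> 0" "b \<noteq> 0"
    and "hinner (momentum a b X) (momentum a b X) < 0"
  shows "G_stable a b (SL2_isotropy (momentum a b X)) X"
  unfolding G_stable_def stable_within_def
proof (intro conjI allI impI)
  let ?G = "SL2_isotropy (momentum a b X)"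
  show "relative_equilibrium a b X"
    using assms by (intro relative_equilibrium_phase_space)
  fix V assume V: "invariant_nbhd ?G phase_space X V"
  define W where "W = {Y \<in> phase_space. hinner (momentum a b Y) (momentum a b Y) < 0}"
  \<comment> \<open>All points whose momentum is timelike and whose whole momentum level lies in
    \<open>V\<close>. Conservation confines trajectories to \<open>V\<close>; openness is where
    properness enters.\<close>
  define U where "U = {Y \<in> W. \<forall>Z\<in>phase_space. momentum a b Z = momentum a b Y \<longrightarrow> Z \<in> V}"
  obtain S where S: "open S" "V = phase_space \<inter> S"
    using V by (auto simp: invariant_nbhd_def openin_open)
  have "openin (top_of_set phase_space) U"
    unfolding openin_euclidean_subtopology_iff
  proof (intro conjI ballI)
    show "U \<subseteq> phase_space" by (auto simp: U_def W_def)
    fix Y0 assume Y0: "Y0 \<in> U"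
    have "((\<lambda>Y. hinner (momentum a b Y) (momentum a b Y)) \<longlongrightarrow> hinner (momentum a b Y0) (momentum a b Y0)) (nhds Y0)"
      by (intro tendsto_intros) (simp_all add: filterlim_ident)
    then have "eventually (\<lambda>Y. hinner (momentum a b Y) (momentum a b Y) < 0) (nhds Y0)"
      by (rule order_tendstoD) (use Y0 in \<open>simp add: U_def W_def\<close>)
    then have "\<exists>e>0. \<forall>Y. dist Y Y0 < e \<longrightarrow> hinner (momentum a b Y) (momentum a b Y) < 0"
      unfolding eventually_nhds_metric .
    then obtain e where e: "e > 0" "\<And>Y. dist Y Y0 < e \<Longrightarrow> hinner (momentum a b Y) (momentum a b Y) < 0"
      by blast
    show "\<exists>d>0. \<forall>Y\<in>phase_space. dist Y Y0 < d \<longrightarrow> Y \<in> U"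
    proof (rule ccontr)
      assume neg: "\<not> ?thesis"
      \<comment> \<open>The radii do not exceed \<open>e\<close>, so \<open>Y\<close> has timelike
        momentum and can miss \<open>U\<close> only through some \<open>Z\<close> of equal momentum
        outside \<open>V\<close>.\<close>
      have "\<exists>Y Z. Y \<in> phase_space \<and> dist Y Y0 < e / Suc n \<and> Z \<in> phase_space
          \<and> momentum a b Z = momentum a b Y \<and> Z \<notin> V" for n
      proof -
        have "e / Suc n > 0" using e by simp
        then obtain Y where Y: "Y \<in> phase_space" "dist Y Y0 < e / Suc n" "Y \<notin> U"
          using neg by blast
        have "e / Suc n \<le> e" using e by (simp add: field_simps)
        with Y e have "Y \<in> W" by (auto simp: W_def)
        with Y(3) obtain Z where "Z \<in> phase_space" "momentum a b Z = momentum a b Y" "Z \<notin> V"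
          unfolding U_def by blast
        with Y show ?thesis by blast
      qed
      then obtain Y Z where YZ: "\<And>n. Y n \<in> phase_space" "\<And>n. dist (Y n) Y0 < e / Suc n"
        "\<And>n. Z n \<in> phase_space" "\<And>n. momentum a b (Z n) = momentum a b (Y n)" "\<And>n. Z n \<notin> V"
        by metis
      have "(\<lambda>n. e / Suc n) \<longlonglongrightarrow> 0"
        by (rule lim_const_over_n[THEN LIMSEQ_Suc])
      then have "(\<lambda>n. dist (Y n) Y0) \<longlonglongrightarrow> 0"
        by (rule tendsto_sandwich[rotated 2, OF tendsto_const])
          (use YZ(2) in \<open>auto intro: less_imp_le always_eventually\<close>)
      then have lim: "Y \<longlonglongrightarrow> Y0" by (rule tendsto_dist_iff[THEN iffD2])
      have tl: "hinner (momentum a b (Y n)) (momentum a b (Y n)) < 0" for n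
      proof (rule e(2))
        have "e / Suc n \<le> e" using e by (simp add: field_simps)
        then show "dist (Y n) Y0 < e" using YZ(2)[of n] by simp
      qed
      have "Y0 \<in> phase_space" "hinner (momentum a b Y0) (momentum a b Y0) < 0"
        using Y0 by (auto simp: U_def W_def)
      then obtain Z0 r where Z0: "strict_mono (r :: nat \<Rightarrow> nat)" "(Z \<circ> r) \<longlonglongrightarrow> Z0"
        "Z0 \<in> phase_space" "momentum a b Z0 = momentum a b Y0"
        using momentum_timelike_compactness[OF assms(2,3) _ YZ(1,3) lim YZ(4) _ tl] by blast
      then have "Z0 \<in> S" using Y0 S by (auto simp: U_def)
      then have "eventually (\<lambda>n. (Z \<circ> r) n \<in> S) sequentially"
        using Z0(2) S(1) by (simp add: tendsto_def)
      then obtain n where "Z (r n) \<in> S"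
        by (auto simp: eventually_sequentially)
      with YZ S show False by auto
    qed
  qed
  moreover have "X \<in> U"
    unfolding U_def W_def
  proof (intro CollectI conjI ballI impI)
    fix Z assume "Z \<in> phase_space" "momentum a b Z = momentum a b X"
    then obtain g where "g \<in> ?G" "sl2_act_pair g X = Z"
      using momentum_level_orbit[OF assms(1) _ assms(2,3)] by metis
    with V show "Z \<in> V" by (auto simp: invariant_nbhd_def)
  qed (use assms in auto)
  moreover have "sl2_act_pair g Y \<in> U" if "g \<in> ?G" "Y \<in> U" for g Y
  proof -
    have g: "g \<in> SL2" "sl2_act g (momentum a b X) = momentum a b X"
      using that by (auto simp: SL2_isotropy_def)
    have "sl2_act_pair g Y \<in> W"
      using that g by (auto simp: U_def W_def momentum_sl2_act_pair hinner_sl2_act phase_space_sl2_act_pair)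
    moreover have "Z \<in> V" if Z: "Z \<in> phase_space" "momentum a b Z = momentum a b (sl2_act_pair g Y)" for Z
    proof -
      \<comment> \<open>Pulling \<open>Z\<close> back by \<open>g\<close> gives a point on the
        momentum level of \<open>Y\<close>, which lies in \<open>V\<close>; invariance of
        \<open>V\<close> returns it to \<open>Z\<close>.\<close>
      let ?Z = "sl2_act_pair (matrix_inv g) Z"
      have "momentum a b ?Z = momentum a b Y"
        using g Z by (simp add: momentum_sl2_act_pair SL2_inv sl2_act_inv)
      moreover have "?Z \<in> phase_space"
        using g Z by (simp add: phase_space_sl2_act_pair SL2_inv)
      ultimately have "?Z \<in> V" using \<open>Y \<in> U\<close> by (auto simp: U_def)
      moreover have "sl2_act_pair g ?Z = Z"
        using g by (cases Z) (simp add: sl2_act_pair_def sl2_act_inv)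
      ultimately show "Z \<in> V"
        using V \<open>g \<in> ?G\<close> unfolding invariant_nbhd_def by (metis image_subset_iff)
    qed
    ultimately show ?thesis by (auto simp: U_def)
  qed
  moreover have "\<phi> ` T \<subseteq> V" if \<phi>: "trajectory a b T \<phi>" "\<phi> ` T \<inter> U \<noteq> {}" for T \<phi>
  proof -
    obtain s where "s \<in> T" "\<phi> s \<in> U" using \<phi>(2) by blast
    moreover have "\<phi> t \<in> phase_space" "momentum a b (\<phi> t) = momentum a b (\<phi> s)" if "t \<in> T" for t
      using trajectory_momentum[OF \<phi>(1) that \<open>s \<in> T\<close>] \<phi>(1) that by (simp_all add: trajectory_def)
    ultimately show ?thesis
      unfolding U_def by blast
  qed
  ultimately show "\<exists>U. invariant_nbhd ?G phase_space X U \<and>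
      (\<forall>T \<phi>. trajectory a b T \<phi> \<and> \<phi> ` T \<inter> U \<noteq> {} \<longrightarrow> \<phi> ` T \<subseteq> V)"
    unfolding invariant_nbhd_def by (metis image_subsetI)
qed

section \<open>Instability for null or spacelike momentum\<close>

text \<open>The one-parameter group generated by \<open>hcross n\<close> for spacelike \<open>n\<close>, in closed form because
  \<open>(hcross n)\<^sup>3 = hinner n n \<cdot> hcross n\<close>.\<close>

definition boost :: "real^3 \<Rightarrow> real \<Rightarrow> real^3 \<Rightarrow> real^3" where
  "boost n s X = (let w = sqrt (hinner n n) in
     X + (sinh (w * s) / w) *\<^sub>R hcross n X + ((cosh (w * s) - 1) / w\<^sup>2) *\<^sub>R hcross n (hcross n X))"

lemma boost_0 [simp]: "boost n 0 X = X"
  by (simp add: boost_def)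

lemma boost_linear: "boost n s (a *\<^sub>R X + b *\<^sub>R Y) = a *\<^sub>R boost n s X + b *\<^sub>R boost n s Y"
  by (simp add: boost_def Let_def algebra_simps)

lemma boost_axis: "boost n s n = n"
  by (simp add: boost_def)

text \<open>The terms even in the parameter cancel, so growth can be read off from the
  \<open>sinh\<close> term alone.\<close>

lemma boost_diff: "boost n s X - boost n (- s) X = (2 * sinh (sqrt (hinner n n) * s) / sqrt (hinner n n)) *\<^sub>R hcross n X"
  by (simp add: boost_def Let_def flip: scaleR_add_left)

lemma hcross_cube: "hcross n (hcross n (hcross n X)) = hinner n n *\<^sub>R hcross n X"
  by (subst hcross_hcross) simp

text \<open>Skewness and the cube relation for \<open>hcross n\<close> reduce the change to a
  multiple of \<open>hinner X (hcross n (hcross n Y))\<close>, whose coefficient vanishes by the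
  identity relating \<open>cosh\<close> and \<open>sinh\<close>.\<close>

lemma hinner_boost:
  assumes "hinner n n > 0"
  shows "hinner (boost n s X) (boost n s Y) = hinner X Y"
proof -
  define w S C where "w = sqrt (hinner n n)" and "S = sinh (w * s) / w" and "C = (cosh (w * s) - 1) / w\<^sup>2"
  have w: "w > 0" "hinner n n = w\<^sup>2" using assms by (auto simp: w_def)
  have "w\<^sup>2 * C\<^sup>2 + 2 * C = ((cosh (w * s))\<^sup>2 - 1) / w\<^sup>2"
    using w(1) by (simp add: C_def field_simps power2_eq_square)
  also have "\<dots> = S\<^sup>2"
    by (simp add: cosh_square_eq S_def power_divide)
  finally have SC: "w\<^sup>2 * C\<^sup>2 + 2 * C = S\<^sup>2" .
  have skew: "hinner (hcross n Z) Y' = - hinner Z (hcross n Y')" for Z Y'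
    by (rule hinner_hcross_skew)
  have "hinner (boost n s X) (boost n s Y)
      = hinner (X + S *\<^sub>R hcross n X + C *\<^sub>R hcross n (hcross n X)) (Y + S *\<^sub>R hcross n Y + C *\<^sub>R hcross n (hcross n Y))"
    by (simp add: boost_def Let_def w_def S_def C_def)
  also have "\<dots> = hinner X Y + (w\<^sup>2 * C\<^sup>2 + 2 * C - S\<^sup>2) * hinner X (hcross n (hcross n Y))"
    by (simp add: skew hcross_cube w(2) algebra_simps power2_eq_square)
  finally show ?thesis by (simp add: SC)
qed

lemma hyp_plane_boost:
  assumes "hinner n n > 0" "X \<in> hyp_plane"
  shows "boost n s X \<in> hyp_plane"
proof (rule hyp_plane_same_sheet[OF assms(2)])
  show "hinner (boost n s X) (boost n s X) = -1"
    using assms by (simp add: hinner_boost hyp_plane_self)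
  \<comment> \<open>The first-order term is orthogonal to \<open>X\<close> and the second-order one
    has nonpositive pairing with it, so the pairing of \<open>X\<close> with its boost stays at most
    -1.\<close>
  have "hinner X (hcross n (hcross n X)) = - hinner n n - (hinner n X)\<^sup>2"
    by (simp add: hcross_hcross hyp_plane_self[OF assms(2)] hinner_commute[of X n] power2_eq_square)
  also have "\<dots> \<le> 0"
    using assms(1) zero_le_power2[of "hinner n X"] by linarith
  finally have "((cosh (sqrt (hinner n n) * s) - 1) / (sqrt (hinner n n))\<^sup>2) * hinner X (hcross n (hcross n X)) \<le> 0"
    using assms(1) by (intro mult_nonneg_nonpos divide_nonneg_nonneg) (auto simp: cosh_real_ge_1)
  then show "hinner X (boost n s X) < 0"
    by (simp add: boost_def Let_def hyp_plane_self[OF assms(2)])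
qed

lemma boost_has_vector_derivative:
  assumes "hinner n n > 0"
  shows "((\<lambda>t. boost n (k * t) X) has_vector_derivative k *\<^sub>R hcross n (boost n (k * t) X)) (at t)"
proof -
  define w where "w = sqrt (hinner n n)"
  have w: "w > 0" "hinner n n = w\<^sup>2" using assms by (auto simp: w_def)
  have "((\<lambda>t. sinh (w * (k * t)) / w) has_real_derivative k * cosh (w * (k * t))) (at t)"
    using w(1) by (auto intro!: derivative_eq_intros)
  moreover have "((\<lambda>t. (cosh (w * (k * t)) - 1) / w\<^sup>2) has_real_derivative k * (sinh (w * (k * t)) / w)) (at t)"
    using w(1) by (auto intro!: derivative_eq_intros simp: power2_eq_square)
  moreover have "((\<lambda>t. X + f t *\<^sub>R P + g t *\<^sub>R Q) has_vector_derivative f' *\<^sub>R P + g' *\<^sub>R Q) (at t)"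
    if "(f has_real_derivative f') (at t)" "(g has_real_derivative g') (at t)" for f g f' g' and P Q :: "real^3"
    using that by (auto intro!: derivative_eq_intros)
  ultimately have "((\<lambda>t. X + (sinh (w * (k * t)) / w) *\<^sub>R hcross n X + ((cosh (w * (k * t)) - 1) / w\<^sup>2) *\<^sub>R hcross n (hcross n X))
      has_vector_derivative (k * cosh (w * (k * t))) *\<^sub>R hcross n X + (k * (sinh (w * (k * t)) / w)) *\<^sub>R hcross n (hcross n X)) (at t)"
    by blast
  moreover have "hcross n (boost n (k * t) X) = hcross n X + (sinh (w * (k * t)) / w) *\<^sub>R hcross n (hcross n X)
      + ((cosh (w * (k * t)) - 1) / w\<^sup>2 * w\<^sup>2) *\<^sub>R hcross n X"
    using w(1) by (simp add: boost_def Let_def hcross_cube w(2))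
  then have "hcross n (boost n (k * t) X)
      = cosh (w * (k * t)) *\<^sub>R hcross n X + (sinh (w * (k * t)) / w) *\<^sub>R hcross n (hcross n X)"
    using w(1) by (simp add: scaleR_left_diff_distrib)
  then have "(k * cosh (w * (k * t))) *\<^sub>R hcross n X + (k * (sinh (w * (k * t)) / w)) *\<^sub>R hcross n (hcross n X)
      = k *\<^sub>R hcross n (boost n (k * t) X)"
    by (simp add: scaleR_add_right)
  ultimately show ?thesis
    by (simp add: boost_def Let_def w_def)
qed

text \<open>Boosts about \<open>n\<close> preserve both the momentum \<open>n\<close> and the
  pairing of the vortices. As \<open>hcross\<close> kills equal arguments, the vortex field along
  the curve is \<open>k\<close> times \<open>hcross n\<close> in each component.\<close>

lemma boost_trajectory:
  assumes "(X, Y) \<in> phase_space" "n = momentum a b (X, Y)" "hinner n n > 0"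
    and "k = 1 / (pi * ((hinner X Y)\<^sup>2 - 1))"
  shows "trajectory a b UNIV (\<lambda>t. (boost n (k * t) X, boost n (k * t) Y))"
  unfolding trajectory_def
proof (intro conjI ballI)
  fix t
  let ?X = "boost n (k * t) X" and ?Y = "boost n (k * t) Y"
  have h: "hinner ?X ?Y = hinner X Y" by (rule hinner_boost[OF assms(3)])
  show "(?X, ?Y) \<in> phase_space"
    using assms(1) phase_spaceD(3)[OF assms(1)] h hyp_plane_boost[OF assms(3)]
    by (intro phase_spaceI) (auto simp: phase_space_def)
  have n: "n = a *\<^sub>R ?X + b *\<^sub>R ?Y"
    using boost_linear[of n "k * t" a X b Y] boost_axis[of n] assms(2) by (simp add: momentum_def)
  have "hcross n ?X = b *\<^sub>R hcross ?Y ?X" "hcross n ?Y = a *\<^sub>R hcross ?X ?Y"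
    using arg_cong[OF n, of "\<lambda>v. hcross v ?X"] arg_cong[OF n, of "\<lambda>v. hcross v ?Y"] by simp_all
  moreover have "1 / pi * (m / ((hinner ?X ?Y)\<^sup>2 - 1)) = k * m" for m
    unfolding h by (simp add: assms(4))
  ultimately have "vortex_field a b (?X, ?Y) = (k *\<^sub>R hcross n ?X, k *\<^sub>R hcross n ?Y)"
    by (simp add: vortex_field_def hinner_commute[of ?Y ?X])
  then show "((\<lambda>t. (boost n (k * t) X, boost n (k * t) Y)) has_vector_derivative vortex_field a b (?X, ?Y)) (at t)"
    using boost_has_vector_derivative[OF assms(3)] by (auto intro!: has_vector_derivative_Pair)
qed auto

text \<open>Moving \<open>Y\<close> off the geodesic through \<open>X\<close> and \<open>Y\<close>, and away from \<open>X\<close>, makes the momentum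
  spacelike; the trajectory then diverges along a boost axis other than that of \<open>\<mu>\<close>, so that the
  \<open>SL2_isotropy \<mu>\<close>-invariant function \<open>hinner (fst _) \<mu>\<close> is unbounded on it.\<close>

lemma not_timelike_imp_not_G_stable:
  assumes XY: "(X, Y) \<in> phase_space" and ab: "a * b < 0"
    and \<mu>: "\<mu> = momentum a b (X, Y)" "hinner \<mu> \<mu> \<ge> 0"
  shows "\<not> G_stable a b (SL2_isotropy \<mu>) (X, Y)"
proof
  assume stable: "G_stable a b (SL2_isotropy \<mu>) (X, Y)"
  note facts = phase_spaceD[OF XY]
  define V where "V = {Z \<in> phase_space. \<bar>hinner (fst Z) \<mu> - hinner X \<mu>\<bar> < 1}"
  have "invariant_nbhd (SL2_isotropy \<mu>) phase_space (X, Y) V"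
    unfolding invariant_nbhd_def
  proof (intro conjI ballI)
    have "open {Z. \<bar>hinner (fst Z) \<mu> - hinner X \<mu>\<bar> < 1}"
      by (intro open_Collect_less continuous_intros)
    moreover have "V = phase_space \<inter> {Z. \<bar>hinner (fst Z) \<mu> - hinner X \<mu>\<bar> < 1}"
      by (auto simp: V_def)
    ultimately show "openin (top_of_set phase_space) V" unfolding openin_open by blast
    show "(X, Y) \<in> V" using XY by (simp add: V_def)
    fix g assume "g \<in> SL2_isotropy \<mu>"
    then have g: "g \<in> SL2" "sl2_act g \<mu> = \<mu>" by (auto simp: SL2_isotropy_def)
    then have "hinner (sl2_act g Z) \<mu> = hinner Z \<mu>" for Z
      by (metis hinner_sl2_act)
    then show "sl2_act_pair g ` V \<subseteq> V"
      using phase_space_sl2_act_pair[OF g(1)] by (auto simp: V_def sl2_act_pair_def)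
  qed
  with stable obtain U where U: "openin (top_of_set phase_space) U" "(X, Y) \<in> U"
    "\<And>T \<phi>. trajectory a b T \<phi> \<Longrightarrow> \<phi> ` T \<inter> U \<noteq> {} \<Longrightarrow> \<phi> ` T \<subseteq> V"
    unfolding G_stable_def stable_within_def invariant_nbhd_def by metis
  define N where "N = hcross X Y"
  define s where "s = hinner N N"
  have s: "s = (hinner X Y)\<^sup>2 - 1" by (simp add: s_def N_def hinner_hcross_norm facts)
  have "s > 0"
    using facts(3) unfolding s by (smt (verit) one_less_power power2_minus pos2)
  \<comment> \<open>Since \<open>N\<close> is orthogonal to \<open>X\<close> and \<open>Y\<close>,
    the square root keeps \<open>Y' \<epsilon>\<close> on the hyperboloid and stretches its pairing
    with \<open>X\<close>.\<close>
  define Y' where "Y' \<epsilon> = sqrt (1 + \<epsilon>\<^sup>2 * s) *\<^sub>R Y + \<epsilon> *\<^sub>R N" for \<epsilon>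
  have root: "sqrt (1 + \<epsilon>\<^sup>2 * s) * sqrt (1 + \<epsilon>\<^sup>2 * s) = 1 + \<epsilon>\<^sup>2 * s" "sqrt (1 + \<epsilon>\<^sup>2 * s) \<ge> 1" for \<epsilon>
    using \<open>s > 0\<close> by simp_all
  have N: "hinner X N = 0" "hinner Y N = 0" "hinner N Y = 0" by (simp_all add: N_def)
  have hXY': "hinner X (Y' \<epsilon>) = sqrt (1 + \<epsilon>\<^sup>2 * s) * hinner X Y" for \<epsilon>
    by (simp add: Y'_def N)
  have PY': "(X, Y' \<epsilon>) \<in> phase_space" for \<epsilon>
  proof (rule phase_spaceI)
    show "X \<in> hyp_plane" using XY by (simp add: phase_space_def)
    show "Y' \<epsilon> \<in> hyp_plane"
    proof (rule hyp_plane_same_sheet)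
      show "Y \<in> hyp_plane" using XY by (simp add: phase_space_def)
      show "hinner (Y' \<epsilon>) (Y' \<epsilon>) = -1"
        using root(1)[of \<epsilon>] by (simp add: Y'_def N facts flip: s_def mult.assoc) (simp add: power2_eq_square)
      show "hinner Y (Y' \<epsilon>) < 0"
        using root(2)[of \<epsilon>] by (simp add: Y'_def N facts)
    qed
    show "hinner X (Y' \<epsilon>) < -1"
      using mult_right_mono_neg[OF root(2)[of \<epsilon>], of "hinner X Y"] facts(3) unfolding hXY' by linarith
  qed
  obtain S where S: "open S" "U = phase_space \<inter> S"
    using U(1) by (auto simp: openin_open)
  have "((\<lambda>\<epsilon>. (X, Y' \<epsilon>)) \<longlongrightarrow> (X, Y' 0)) (at_right 0)"
    unfolding Y'_def by (intro tendsto_intros)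
  then have "eventually (\<lambda>\<epsilon>. (X, Y' \<epsilon>) \<in> S) (at_right 0)"
    using S U(2) by (auto simp: tendsto_def Y'_def)
  then have "eventually (\<lambda>\<epsilon>. (X, Y' \<epsilon>) \<in> S \<and> \<epsilon> > 0) (at_right 0)"
    by (intro eventually_conj eventually_at_right_less)
  then obtain \<epsilon> where \<epsilon>: "(X, Y' \<epsilon>) \<in> S" "\<epsilon> > 0"
    using eventually_happens'[OF trivial_limit_at_right_real] by blast
  define n where "n = momentum a b (X, Y' \<epsilon>)"
  have "sqrt (1 + \<epsilon>\<^sup>2 * s) > 1"
    using \<epsilon>(2) \<open>s > 0\<close> by simp
  then have "hinner X (Y' \<epsilon>) < hinner X Y"
    unfolding hXY' using mult_strict_right_mono_neg[of 1 _ "hinner X Y"] facts(3) by fastforce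
  \<comment> \<open>For vorticities of opposite sign, a larger distance raises the Minkowski square
    of the momentum, here strictly above \<open>hinner \<mu> \<mu>\<close>.\<close>
  then have "2 * a * b * hinner X (Y' \<epsilon>) > 2 * a * b * hinner X Y"
    using ab by (intro mult_strict_left_mono_neg) auto
  then have nn: "hinner n n > 0"
    using \<mu>(2) unfolding n_def \<mu>(1) hinner_momentum[OF XY] hinner_momentum[OF PY'] by simp
  define k where "k = 1 / (pi * ((hinner X (Y' \<epsilon>))\<^sup>2 - 1))"
  have "(hinner X (Y' \<epsilon>))\<^sup>2 > 1"
    using phase_spaceD(3)[OF PY'[of \<epsilon>]] by (smt (verit) one_less_power power2_minus pos2)
  then have "k \<noteq> 0" by (simp add: k_def)
  define \<phi> where "\<phi> t = (boost n (k * t) X, boost n (k * t) (Y' \<epsilon>))" for t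
  have "trajectory a b UNIV \<phi>"
    unfolding \<phi>_def using boost_trajectory[OF PY' n_def nn k_def] .
  moreover have "\<phi> 0 \<in> U"
    using \<epsilon>(1) S PY' by (simp add: \<phi>_def)
  ultimately have "\<phi> t \<in> V" for t
    using U(3)[of UNIV \<phi>] by blast
  then have bound: "\<bar>hinner (boost n (k * t) X) \<mu> - hinner X \<mu>\<bar> < 1" for t
    by (simp add: V_def \<phi>_def)
  \<comment> \<open>The initial rate of change of the pairing with \<open>\<mu>\<close> under the
    boost. Only the \<open>N\<close> component of \<open>n\<close> contributes, because
    \<open>X\<close>, \<open>Y\<close> and \<open>\<mu>\<close> are coplanar.\<close>
  define B where "B = hinner (hcross n X) \<mu>"
  have "B = b\<^sup>2 * \<epsilon> * hinner (hcross N X) Y"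
    by (simp add: B_def n_def \<mu>(1) momentum_def Y'_def power2_eq_square)
  also have "hinner (hcross N X) Y = s"
    unfolding hinner_hcross_cycle[of N X Y] by (simp add: s_def N_def)
  finally have "B \<noteq> 0" using \<epsilon>(2) \<open>s > 0\<close> ab by auto
  define w where "w = sqrt (hinner n n)"
  have "w > 0" using nn by (simp add: w_def)
  \<comment> \<open>Chosen so that the pairings with \<open>\<mu>\<close> at times \<open>t\<close>
    and \<open>- t\<close> differ by exactly 2, while both lie strictly within 1 of
    \<open>hinner X \<mu>\<close>.\<close>
  define t where "t = arsinh (w / B) / (w * k)"
  have "w * (k * t) = arsinh (w / B)"
    using \<open>w > 0\<close> \<open>k \<noteq> 0\<close> by (simp add: t_def)
  then have "hinner (boost n (k * t) X - boost n (- (k * t)) X) \<mu> = 2"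
    using \<open>w > 0\<close> \<open>B \<noteq> 0\<close> unfolding boost_diff w_def[symmetric] hinner_linear B_def[symmetric] by simp
  with bound[of t] bound[of "- t"] show False by simp
qed

section \<open>The dichotomy by the sign of the Minkowski square of the momentum\<close>

theorem theorem9:
  fixes \<Gamma>\<^sub>1 \<Gamma>\<^sub>2 c :: real and X\<^sub>1 X\<^sub>2 \<mu> :: "real^3"
  assumes "(X\<^sub>1, X\<^sub>2) \<in> phase_space"
    and "\<Gamma>\<^sub>1 \<noteq> 0" and "\<Gamma>\<^sub>2 \<noteq> 0"
    and "c = hyp_dist X\<^sub>1 X\<^sub>2"
    and "\<mu> = momentum \<Gamma>\<^sub>1 \<Gamma>\<^sub>2 (X\<^sub>1, X\<^sub>2)"
  shows "if sgn \<Gamma>\<^sub>1 = sgn \<Gamma>\<^sub>2 \<or>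
            (sgn \<Gamma>\<^sub>1 = - sgn \<Gamma>\<^sub>2 \<and> c < \<bar>ln \<bar>\<Gamma>\<^sub>1\<bar> - ln \<bar>\<Gamma>\<^sub>2\<bar>\<bar>)
         then G_stable \<Gamma>\<^sub>1 \<Gamma>\<^sub>2 (SL2_isotropy \<mu>) (X\<^sub>1, X\<^sub>2)
         else leafwise_stable \<Gamma>\<^sub>1 \<Gamma>\<^sub>2 (X\<^sub>1, X\<^sub>2) \<and>
              \<not> G_stable \<Gamma>\<^sub>1 \<Gamma>\<^sub>2 (SL2_isotropy \<mu>) (X\<^sub>1, X\<^sub>2)"
proof -
  have same: "sgn \<Gamma>\<^sub>1 = sgn \<Gamma>\<^sub>2 \<longleftrightarrow> \<Gamma>\<^sub>1 * \<Gamma>\<^sub>2 > 0" and opp: "sgn \<Gamma>\<^sub>1 = - sgn \<Gamma>\<^sub>2 \<longleftrightarrow> \<Gamma>\<^sub>1 * \<Gamma>\<^sub>2 < 0"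
    using assms(2,3) by (auto simp: sgn_if zero_less_mult_iff mult_less_0_iff)
  have "hinner \<mu> \<mu> < 0" if "\<Gamma>\<^sub>1 * \<Gamma>\<^sub>2 > 0"
  proof -
    have "\<Gamma>\<^sub>1 * \<Gamma>\<^sub>2 * hinner X\<^sub>1 X\<^sub>2 < 0"
      using that phase_spaceD(3)[OF assms(1)] by (intro mult_pos_neg) auto
    then have "2 * (\<Gamma>\<^sub>1 * \<Gamma>\<^sub>2 * hinner X\<^sub>1 X\<^sub>2) - \<Gamma>\<^sub>1\<^sup>2 - \<Gamma>\<^sub>2\<^sup>2 < 0"
      using zero_le_power2[of \<Gamma>\<^sub>1] zero_le_power2[of \<Gamma>\<^sub>2] by linarith
    then show ?thesis
      unfolding assms(5) hinner_momentum[OF assms(1)] by (simp only: mult.assoc)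
  qed
  then have "(sgn \<Gamma>\<^sub>1 = sgn \<Gamma>\<^sub>2 \<or> (sgn \<Gamma>\<^sub>1 = - sgn \<Gamma>\<^sub>2 \<and> c < \<bar>ln \<bar>\<Gamma>\<^sub>1\<bar> - ln \<bar>\<Gamma>\<^sub>2\<bar>\<bar>)) \<longleftrightarrow> hinner \<mu> \<mu> < 0"
    using hyp_dist_less_ln_ratio_iff[OF assms(1), of \<Gamma>\<^sub>1 \<Gamma>\<^sub>2] assms(2-5) unfolding same opp
    by (metis linorder_neqE_linordered_idom mult_eq_0_iff)
  \<comment> \<open>Vorticities of the same sign always give a timelike momentum, so the unstable
    case has opposite signs.\<close>
  moreover have "\<Gamma>\<^sub>1 * \<Gamma>\<^sub>2 < 0" if "\<not> hinner \<mu> \<mu> < 0"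
    using calculation that assms(2,3) unfolding same
    by (metis linorder_neqE_linordered_idom mult_eq_0_iff)
  ultimately show ?thesis
    using timelike_imp_G_stable[OF assms(1-3)] leafwise_stable_phase_space[OF assms(1-3)]
      not_timelike_imp_not_G_stable[OF assms(1), of \<Gamma>\<^sub>1 \<Gamma>\<^sub>2 \<mu>] assms(5)
    by (simp add: not_less)
qed

end
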